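(* Let $S$ be a topological semigroup whose underlying topological space is compact and Hausdorff. (i) If $\lambda$ is a continuous left unit operation on $S$, then the topological left unosemigroup $(S,\lambda)$ is ditopological. (ii) If $\rho$ is a continuous right unit operation on $S$, then the topological right unosemigroup $(S,\rho)$ is ditopological. (iii) If $\lambda$ and $\rho$ are a continuous left unit operation and a continuous right unit operation on $S$, then the topological unosemigroup $(S,\lambda,\rho)$ is ditopological.
   Context: A topological semigroup is a non-empty topological space $S$ endowed with a continuous associative binary operation $\cdot:S\times S\to S$. A left (resp. right) unit operation on $S$ is a map $\lambda:S\to S$ with $\lambda(x)\cdot x=x$ (resp. a map $\rho:S\to S$ with $x\cdot\rho(x)=x$) for all $x\in S$. A topological left unosemigroup $(S,\lambda)$ (right unosemigroup $(S,\rho)$, unosemigroup $(S,\lambda,\rho)$) is a topological semigroup with a continuous left unit operation $\lambda$ (a continuous right unit operation $\rho$, both). For $A,B\subset S$ put $A\leftthreetimes B=\{x\in S: ax\in B \text{ for some } a\in A\}$ and $B\rightthreetimes A=\{x\in S: xa\in B\text{ for some }a\in A\}$. A continuous left unit operation $\lambda$ is dicontinuous if for every $x\in S$ and every neighborhood $O_x\subset S$ of $x$ there are a neighborhood $U_x\subset S$ of $x$ and a neighborhood $W_{\lambda(x)}\subset\lambda(S)$ of $\lambda(x)$ in the subspace $\lambda(S)$ such that $(W_{\lambda(x)}\leftthreetimes U_x)\cap\lambda^{-1}(W_{\lambda(x)})\subset O_x$. A continuous right unit operation $\rho$ is dicontinuous if for every $x\in S$ and every neighborhood $O_x\subset S$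 of $x$ there are a neighborhood $U_x\subset S$ of $x$ and a neighborhood $W_{\rho(x)}\subset\rho(S)$ of $\rho(x)$ in the subspace $\rho(S)$ such that $(U_x\rightthreetimes W_{\rho(x)})\cap\rho^{-1}(W_{\rho(x)})\subset O_x$. A topological left unosemigroup $(S,\lambda)$ (right unosemigroup $(S,\rho)$, unosemigroup $(S,\lambda,\rho)$) is ditopological if $\lambda$ is dicontinuous ($\rho$ is dicontinuous, both $\lambda$ and $\rho$ are dicontinuous). *)

theory Defs
  imports "HOL-Analysis.Analysis"
begin

text \<open>
  A topological semigroup is a type of class \<^class>\<open>topological_semigroup_mult\<close>; types being
  non-empty, the carrier is \<open>UNIV\<close> and is automatically non-empty.
\<close>

definition left_quotient :: "'a::semigroup_mult set \<Rightarrow> 'a set \<Rightarrow> 'a set" where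
  "left_quotient A B = {x. \<exists>a\<in>A. a * x \<in> B}"

definition right_quotient :: "'a::semigroup_mult set \<Rightarrow> 'a set \<Rightarrow> 'a set" where
  "right_quotient B A = {x. \<exists>a\<in>A. x * a \<in> B}"

definition left_unit_operation :: "('a::semigroup_mult \<Rightarrow> 'a) \<Rightarrow> bool" where
  "left_unit_operation l \<longleftrightarrow> (\<forall>x. l x * x = x)"

definition right_unit_operation :: "('a::semigroup_mult \<Rightarrow> 'a) \<Rightarrow> bool" where
  "right_unit_operation r \<longleftrightarrow> (\<forall>x. x * r x = x)"

text \<open>Neighbourhoods need not be open.\<close>

definition neighborhood_in :: "'a topology \<Rightarrow> 'a \<Rightarrow> 'a set \<Rightarrow> bool" where
  "neighborhood_in T x U \<longleftrightarrow> U \<subseteq> topspace T \<and> (\<exists>V. openin T V \<and> x \<in> V \<and> V \<subseteq> U)"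

definition left_dicontinuous :: "('a::topological_semigroup_mult \<Rightarrow> 'a) \<Rightarrow> bool" where
  "left_dicontinuous l \<longleftrightarrow>
    (\<forall>x Ox. neighborhood_in euclidean x Ox \<longrightarrow>
      (\<exists>U W. neighborhood_in euclidean x U \<and>
             neighborhood_in (top_of_set (range l)) (l x) W \<and>
             left_quotient W U \<inter> l -` W \<subseteq> Ox))"

definition right_dicontinuous :: "('a::topological_semigroup_mult \<Rightarrow> 'a) \<Rightarrow> bool" where
  "right_dicontinuous r \<longleftrightarrow>
    (\<forall>x Ox. neighborhood_in euclidean x Ox \<longrightarrow>
      (\<exists>U W. neighborhood_in euclidean x U \<and>
             neighborhood_in (top_of_set (range r)) (r x) W \<and>
             right_quotient U W \<inter> r -` W \<subseteq> Ox))"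

definition topological_left_unosemigroup :: "('a::topological_semigroup_mult \<Rightarrow> 'a) \<Rightarrow> bool" where
  "topological_left_unosemigroup l \<longleftrightarrow> left_unit_operation l \<and> continuous_on UNIV l"

definition topological_right_unosemigroup :: "('a::topological_semigroup_mult \<Rightarrow> 'a) \<Rightarrow> bool" where
  "topological_right_unosemigroup r \<longleftrightarrow> right_unit_operation r \<and> continuous_on UNIV r"

definition topological_unosemigroup ::
    "('a::topological_semigroup_mult \<Rightarrow> 'a) \<Rightarrow> ('a \<Rightarrow> 'a) \<Rightarrow> bool" where
  "topological_unosemigroup l r \<longleftrightarrow>
    topological_left_unosemigroup l \<and> topological_right_unosemigroup r"

definition ditopological_left_unosemigroup :: "('a::topological_semigroup_mult \<Rightarrow> 'a) \<Rightarrow> bool" where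
  "ditopological_left_unosemigroup l \<longleftrightarrow>
    topological_left_unosemigroup l \<and> left_dicontinuous l"

definition ditopological_right_unosemigroup :: "('a::topological_semigroup_mult \<Rightarrow> 'a) \<Rightarrow> bool" where
  "ditopological_right_unosemigroup r \<longleftrightarrow>
    topological_right_unosemigroup r \<and> right_dicontinuous r"

definition ditopological_unosemigroup ::
    "('a::topological_semigroup_mult \<Rightarrow> 'a) \<Rightarrow> ('a \<Rightarrow> 'a) \<Rightarrow> bool" where
  "ditopological_unosemigroup l r \<longleftrightarrow>
    topological_unosemigroup l r \<and> left_dicontinuous l \<and> right_dicontinuous r"

end

theory Submission
  imports Defs
begin

text \<open>
  A point \<open>y\<close> outside the given neighbourhood of \<open>x\<close> is excluded for one of two reasons: either
  \<open>l y \<noteq> l x\<close>, and the two values are separated by the Hausdorff property; or \<open>l y = l x\<close>, so that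
  \<open>l x * y = y \<noteq> x\<close>, and \<open>a * z\<close> stays away from \<open>x\<close> for all \<open>a\<close> near \<open>l x\<close> and \<open>z\<close> near \<open>y\<close>.
  Finitely many such \<open>y\<close> suffice by compactness.
\<close>

lemma unit_separation_pointwise:
  fixes f :: "'a \<Rightarrow> 'a \<Rightarrow> 'a::t2_space" and l :: "'a \<Rightarrow> 'a"
  assumes contl: "continuous_on UNIV l"
    and contf: "continuous_on UNIV (\<lambda>(a, z). f a z)"
    and unit: "\<And>x. f (l x) x = x"
    and "y \<noteq> x"
  obtains V U W where "open V" "y \<in> V" "open U" "x \<in> U" "open W" "l x \<in> W"
    "\<And>a z. a \<in> W \<Longrightarrow> z \<in> V \<Longrightarrow> l z \<in> W \<Longrightarrow> f a z \<notin> U"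
proof (cases "l y = l x")
  case False
  then obtain A W where AW: "open A" "open W" "l y \<in> A" "l x \<in> W" "A \<inter> W = {}"
    by (meson hausdorff)
  show thesis
  proof (rule that[of "l -` A" UNIV W])
    show "open (l -` A)" using contl AW(1) by (simp add: open_vimage)
    show "f a z \<notin> UNIV" if "a \<in> W" "z \<in> l -` A" "l z \<in> W" for a z
      using that AW(5) by blast
  qed (use AW in simp_all)
next
  case True
  obtain A U where AU: "open A" "open U" "y \<in> A" "x \<in> U" "A \<inter> U = {}"
    using \<open>y \<noteq> x\<close> by (meson hausdorff)
  \<comment> \<open>Since \<open>l y = l x\<close>, the unit law gives
    \<open>f (l x) y = y \<in> A\<close>. Joint continuity then yields a box
    \<open>W \<times> V\<close> around \<open>(l x, y)\<close> that \<open>f\<close> maps into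
    \<open>A\<close>, hence off \<open>U\<close>.\<close>
  have "open ((\<lambda>(a, z). f a z) -` A)"
    using contf AU(1) by (simp add: open_vimage)
  moreover have "(l x, y) \<in> (\<lambda>(a, z). f a z) -` A"
    using AU(3) unit[of y] True by simp
  ultimately obtain W V where WV: "open W" "open V" "(l x, y) \<in> W \<times> V"
      "W \<times> V \<subseteq> (\<lambda>(a, z). f a z) -` A"
    by (rule open_prod_elim)
  show thesis
  proof (rule that)
    show "f a z \<notin> U" if "a \<in> W" "z \<in> V" for a z
      using WV(4) that AU(5) by auto
  qed (use WV AU in auto)
qed

text \<open>Makes \<open>U\<close> and \<open>W\<close> independent of the point to be excluded:
  \<open>-G\<close> is compact, so finitely many of the sets \<open>V y\<close> cover it, and the
  matching \<open>U y\<close> and \<open>W y\<close> can be intersected.\<close>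

lemma compact_unit_separation:
  fixes f :: "'a \<Rightarrow> 'a \<Rightarrow> 'a::t2_space" and l :: "'a \<Rightarrow> 'a"
  assumes compact: "compact (UNIV :: 'a set)"
    and contl: "continuous_on UNIV l"
    and contf: "continuous_on UNIV (\<lambda>(a, z). f a z)"
    and unit: "\<And>x. f (l x) x = x"
    and G: "open G" "x \<in> G"
  obtains U W where "open U" "x \<in> U" "open W" "l x \<in> W"
    "\<And>a z. a \<in> W \<Longrightarrow> f a z \<in> U \<Longrightarrow> l z \<in> W \<Longrightarrow> z \<in> G"
proof -
  have "\<forall>y\<in>-G. \<exists>V U W. open V \<and> y \<in> V \<and> open U \<and> x \<in> U \<and> open W \<and> l x \<in> W \<and>
      (\<forall>a z. a \<in> W \<longrightarrow> z \<in> V \<longrightarrow> l z \<in> W \<longrightarrow> f a z \<notin> U)"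
  proof
    fix y assume "y \<in> -G"
    then have "y \<noteq> x" using G by auto
    then show "\<exists>V U W. open V \<and> y \<in> V \<and> open U \<and> x \<in> U \<and> open W \<and> l x \<in> W \<and>
        (\<forall>a z. a \<in> W \<longrightarrow> z \<in> V \<longrightarrow> l z \<in> W \<longrightarrow> f a z \<notin> U)"
      by (rule unit_separation_pointwise[OF contl contf unit]) blast
  qed
  then obtain V U W where V: "\<And>y. y \<in> -G \<Longrightarrow> open (V y)" "\<And>y. y \<in> -G \<Longrightarrow> y \<in> V y"
    and U: "\<And>y. y \<in> -G \<Longrightarrow> open (U y)" "\<And>y. y \<in> -G \<Longrightarrow> x \<in> U y"
    and W: "\<And>y. y \<in> -G \<Longrightarrow> open (W y)" "\<And>y. y \<in> -G \<Longrightarrow> l x \<in> W y"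
    and sep: "\<And>y a z. y \<in> -G \<Longrightarrow> a \<in> W y \<Longrightarrow> z \<in> V y \<Longrightarrow> l z \<in> W y \<Longrightarrow> f a z \<notin> U y"
    unfolding bchoice_iff by blast
  have c: "compact (-G)"
    using compact_Int_closed[OF compact closed_Compl[OF G(1)]] by simp
  have cover: "-G \<subseteq> (\<Union>y\<in>-G. V y)"
    using V(2) by blast
  obtain D where D: "D \<subseteq> -G" "finite D" "-G \<subseteq> (\<Union>y\<in>D. V y)"
    by (rule compactE_image[OF c V(1) cover])
  show thesis
  proof (rule that)
    \<comment> \<open>Finiteness of \<open>D\<close> keeps the intersections open. For empty
      \<open>D\<close>, which forces \<open>G = UNIV\<close>, both are the whole space.\<close>
    show "open (\<Inter>y\<in>D. U y)" "open (\<Inter>y\<in>D. W y)"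
      using D(1) by (auto intro!: open_INT[OF D(2)] U(1) W(1))
    show "x \<in> (\<Inter>y\<in>D. U y)" "l x \<in> (\<Inter>y\<in>D. W y)"
      using D(1) by (auto intro!: U(2) W(2))
    show "z \<in> G" if *: "a \<in> (\<Inter>y\<in>D. W y)" "f a z \<in> (\<Inter>y\<in>D. U y)" "l z \<in> (\<Inter>y\<in>D. W y)" for a z
    proof (rule ccontr)
      assume "z \<notin> G"
      then obtain y where y: "y \<in> D" "z \<in> V y" using D(3) by blast
      then have "f a z \<notin> U y" using * D(1) by (intro sep) auto
      then show False using *(2) y(1) by blast
    qed
  qed
qed

text \<open>The common form of both dicontinuity conditions: with \<open>f\<close> an arbitrary
  jointly continuous operation, it covers multiplication in either order.\<close>

lemma compact_unit_neighborhoods: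
  fixes f :: "'a \<Rightarrow> 'a \<Rightarrow> 'a::t2_space" and l :: "'a \<Rightarrow> 'a"
  assumes "compact (UNIV :: 'a set)" "continuous_on UNIV l"
    and "continuous_on UNIV (\<lambda>(a, z). f a z)" "\<And>x. f (l x) x = x"
    and "neighborhood_in euclidean x Ox"
  shows "\<exists>U W. neighborhood_in euclidean x U \<and> neighborhood_in (top_of_set (range l)) (l x) W \<and>
    {z. \<exists>a\<in>W. f a z \<in> U} \<inter> l -` W \<subseteq> Ox"
proof -
  obtain G where G: "open G" "x \<in> G" "G \<subseteq> Ox"
    using assms(5) by (auto simp: neighborhood_in_def)
  obtain U W where UW: "open U" "x \<in> U" "open W" "l x \<in> W"
    "\<And>a z. a \<in> W \<Longrightarrow> f a z \<in> U \<Longrightarrow> l z \<in> W \<Longrightarrow> z \<in> G"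
    using compact_unit_separation[OF assms(1-4) G(1,2)] by metis
  have "neighborhood_in euclidean x U"
    using UW by (auto simp: neighborhood_in_def)
  \<comment> \<open>Dicontinuity asks for a neighborhood within the subspace \<open>range l\<close>,
    so \<open>W\<close> is replaced by its trace there. This only shrinks the set to be bounded by
    \<open>Ox\<close>.\<close>
  moreover have "neighborhood_in (top_of_set (range l)) (l x) (range l \<inter> W)"
    using UW unfolding neighborhood_in_def by (auto intro!: exI[of _ "range l \<inter> W"])
  moreover have "{z. \<exists>a\<in>range l \<inter> W. f a z \<in> U} \<inter> l -` (range l \<inter> W) \<subseteq> Ox"
    using UW(5) G(3) by blast
  ultimately show ?thesis by blast
qed

lemma compact_left_dicontinuous:
  fixes l :: "'a::{topological_semigroup_mult, t2_space} \<Rightarrow> 'a"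
  assumes "compact (UNIV :: 'a set)" "left_unit_operation l" "continuous_on UNIV l"
  shows "left_dicontinuous l"
  unfolding left_dicontinuous_def left_quotient_def
proof (intro allI impI, rule compact_unit_neighborhoods)
  show "continuous_on UNIV (\<lambda>(a, z). a * z :: 'a)"
    by (auto simp: case_prod_unfold intro!: continuous_intros)
qed (use assms in \<open>auto simp: left_unit_operation_def\<close>)

text \<open>The left case for the opposite multiplication \<open>f a z = z * a\<close>, under which
  \<open>x * r x = x\<close> reads \<open>f (r x) x = x\<close>.\<close>

lemma compact_right_dicontinuous:
  fixes r :: "'a::{topological_semigroup_mult, t2_space} \<Rightarrow> 'a"
  assumes "compact (UNIV :: 'a set)" "right_unit_operation r" "continuous_on UNIV r"
  shows "right_dicontinuous r"
  unfolding right_dicontinuous_def right_quotient_def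
proof (intro allI impI, rule compact_unit_neighborhoods)
  show "continuous_on UNIV (\<lambda>(a, z). z * a :: 'a)"
    by (auto simp: case_prod_unfold intro!: continuous_intros)
qed (use assms in \<open>auto simp: right_unit_operation_def\<close>)

theorem corollary1:
  assumes "compact (UNIV :: 'a::{topological_semigroup_mult, t2_space} set)"
  shows "(\<forall>l :: 'a \<Rightarrow> 'a. left_unit_operation l \<and> continuous_on UNIV l \<longrightarrow>
            ditopological_left_unosemigroup l) \<and>
         (\<forall>r :: 'a \<Rightarrow> 'a. right_unit_operation r \<and> continuous_on UNIV r \<longrightarrow>
            ditopological_right_unosemigroup r) \<and>
         (\<forall>(l :: 'a \<Rightarrow> 'a) (r :: 'a \<Rightarrow> 'a).
            left_unit_operation l \<and> continuous_on UNIV l \<and>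
            right_unit_operation r \<and> continuous_on UNIV r \<longrightarrow>
            ditopological_unosemigroup l r)"
  using compact_left_dicontinuous[OF assms] compact_right_dicontinuous[OF assms]
  by (simp add: ditopological_left_unosemigroup_def ditopological_right_unosemigroup_def
      ditopological_unosemigroup_def topological_unosemigroup_def
      topological_left_unosemigroup_def topological_right_unosemigroup_def)

end
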